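(* Let $G$ be a GEV choice probability generating function on $m$ products with costs $c\in\mathbb{R}^m$, and let $\mathcal{A}\subset\mathbb{R}^{2m}$ be a nonempty convex compact uncertainty set such that every $(a,b)\in\mathcal{A}$ satisfies $b_1=\dots=b_m>0$. Then there always exists a unique solution $z^*\in\mathbb{R}$ to the fixed point problem $$z=\frac{1+W\big(G(Y|0,a^*(z),b^*(z))\,e^{-1}\big)}{\langle b^*(z)\rangle},$$ where $W$ is the Lambert-W function, and the constant-markup price vector $x^*$ defined by $x^*_i=z^*+c_i$ for all $i\in\{1,\dots,m\}$ is the unique optimal solution of the robust problem $$\max_{x\in\mathbb{R}^m}\ \min_{(a,b)\in\mathcal{A}}\ \Phi(x,a,b).$$ Moreover, $(x^*,a^*(z^* ),b^*(z^* ))$ is a saddle point of this max-min problem, and the minimax equality holds: $$\max_{x\in\mathbb{R}^m}\min_{(a,b)\in\mathcal{A}}\Phi(x,a,b)=\min_{(a,b)\in\mathcal{A}}\max_{x\in\mathbb{R}^m}\Phi(x,a,b).$$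
   Context: Products are indexed by $\mathcal{V}=\{1,\dots,m\}$. A GEV choice probability generating function (CPGF) is a smooth function $G$ of vectors $Y=(Y_1,\dots,Y_m)$ with positive entries such that: (i) $G(Y)\ge 0$; (ii) $G(\lambda Y)=\lambda G(Y)$ for $\lambda>0$; (iii) $G(Y)\to\infty$ if $Y_i\to\infty$; (iv) for distinct $i_1,\dots,i_k$, the mixed partial derivative $\partial G_{i_1,\dots,i_k}(Y)$ is $>0$ if $k$ is odd and $\le 0$ if $k$ is even. (Consequently $G(Y)=\sum_i Y_i\partial G_i(Y)$ and $\sum_j Y_j\partial G_{ij}(Y)=0$ for all $i$.) The choice probability of product $i$ is $P_i(Y|G)=Y_i\partial G_i(Y)/(1+G(Y))$. For prices $x\in\mathbb{R}^m$ and choice parameters $(a,b)\in\mathbb{R}^{2m}$, let $Y_i(x,a,b)=\exp(a_i-b_ix_i)$ and $\Phi(x,a,b)=\sum_{i=1}^m (x_i-c_i)P_i(Y(x,a,b)|G)$. For a vector $b$ with all equal entries, $\langle b\rangle$ denotes the common value. For $z\in\mathbb{R}$, $G(Y|z,a,b):=G(Y_1,\dots,Y_m)$ with $Y_i=e^{a_i-b_i(z+c_i)}$, and $(a^*(z),b^*(z))$ denotes the unique minimizer $\operatorname{argmin}_{(a,b)\in\mathcal{A}}G(Y|z,a,b)$. A saddle point $(x^*,a^*,b^* )$ means $\Phi(x,a^*,b^* )\le\Phi(x^*,a^*,b^* )\le\Phi(x^*,a,b)$ for all $x\in\mathbb{R}^m$, $(a,b)\in\mathcal{A}$.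
   Formalization: The minimizer (a*(z),b*(z)) need not be unique for every z, so the fixed point problem is read as: some minimizer (a,b) of G(Y|z,·) over A satisfies the equation at z; z* is unique, and so is the minimizer satisfying the equation at z*, which serves as (a*(z* ),b*(z* )). *)

theory Defs
  imports "HOL-Analysis.Analysis"
begin

text \<open>The products are the elements of the finite type \<open>'m\<close>; \<open>m\<close> is \<open>CARD('m)\<close>.\<close>

section \<open>Choice probability generating functions\<close>

definition pos_orthant :: "(real ^ 'm) set" where
  "pos_orthant = {Y. \<forall>i. 0 < Y $ i}"

definition partial_deriv :: "'m \<Rightarrow> (real ^ 'm \<Rightarrow> real) \<Rightarrow> real ^ 'm \<Rightarrow> real" where
  "partial_deriv i f Y = deriv (\<lambda>t. f (Y + t *\<^sub>R axis i 1)) 0"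

primrec mixed_partial :: "'m list \<Rightarrow> (real ^ 'm \<Rightarrow> real) \<Rightarrow> real ^ 'm \<Rightarrow> real" where
  "mixed_partial [] f = f"
| "mixed_partial (i # is) f = partial_deriv i (mixed_partial is f)"

text \<open>On the open positive orthant, Frechet differentiability of all iterated partial
  derivatives (including the function itself) is the same as being infinitely often continuously
  differentiable.\<close>

definition smooth_on_orthant :: "(real ^ 'm \<Rightarrow> real) \<Rightarrow> bool" where
  "smooth_on_orthant f \<longleftrightarrow> (\<forall>is. \<forall>Y\<in>pos_orthant. mixed_partial is f differentiable (at Y))"

text \<open>Values of \<open>G\<close> outside the positive orthant are unconstrained and never used.
  Divergence in \<open>Y\<^sub>i\<close> is taken with the other (positive) coordinates held fixed.\<close>

definition GEV_CPGF :: "(real ^ 'm \<Rightarrow> real) \<Rightarrow> bool" where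
  "GEV_CPGF G \<longleftrightarrow>
     smooth_on_orthant G \<and>
     (\<forall>Y\<in>pos_orthant. 0 \<le> G Y) \<and>
     (\<forall>Y\<in>pos_orthant. \<forall>l>0. G (l *\<^sub>R Y) = l * G Y) \<and>
     (\<forall>Y\<in>pos_orthant. \<forall>i.
        filterlim (\<lambda>t. G (\<chi> j. if j = i then t else Y $ j)) at_top at_top) \<and>
     (\<forall>is. is \<noteq> [] \<and> distinct is \<longrightarrow>
        (\<forall>Y\<in>pos_orthant.
           (odd (length is) \<longrightarrow> 0 < mixed_partial is G Y) \<and>
           (even (length is) \<longrightarrow> mixed_partial is G Y \<le> 0)))"

definition choice_prob :: "(real ^ 'm \<Rightarrow> real) \<Rightarrow> real ^ 'm \<Rightarrow> 'm \<Rightarrow> real" where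
  "choice_prob G Y i = Y $ i * partial_deriv i G Y / (1 + G Y)"

section \<open>Pricing\<close>

text \<open>Choice parameters \<open>(a, b)\<close> are pairs of vectors.\<close>

type_synonym 'm params = "(real ^ 'm) \<times> (real ^ 'm)"

definition attraction :: "real ^ 'm \<Rightarrow> 'm params \<Rightarrow> real ^ 'm" where
  "attraction x p = (\<chi> i. exp (fst p $ i - snd p $ i * x $ i))"

definition profit :: "(real ^ 'm \<Rightarrow> real) \<Rightarrow> real ^ 'm \<Rightarrow> real ^ 'm \<Rightarrow> 'm params \<Rightarrow> real" where
  "profit G c x p = (\<Sum>i\<in>UNIV. (x $ i - c $ i) * choice_prob G (attraction x p) i)"

definition markup_price :: "real ^ 'm \<Rightarrow> real \<Rightarrow> real ^ 'm" where
  "markup_price c z = (\<chi> i. z + c $ i)"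

text \<open>\<open>G_markup G c z (a, b)\<close> is \<open>G(Y | z, a, b)\<close>.\<close>

definition G_markup :: "(real ^ 'm \<Rightarrow> real) \<Rightarrow> real ^ 'm \<Rightarrow> real \<Rightarrow> 'm params \<Rightarrow> real" where
  "G_markup G c z p = G (attraction (markup_price c z) p)"

definition common_value :: "real ^ 'm \<Rightarrow> real" where
  "common_value b = (THE t. \<forall>i. b $ i = t)"

text \<open>Principal branch; only used at nonnegative arguments.\<close>

definition lambert_W :: "real \<Rightarrow> real" where
  "lambert_W y = (THE w. -1 \<le> w \<and> w * exp w = y)"

text \<open>The fixed point problem, with \<open>p\<close> in the role of \<open>(a\<^sup>*(z), b\<^sup>*(z))\<close>. The minimizer of
  \<open>G(Y | z, \<cdot>)\<close> over \<open>A\<close> can fail to be unique for exceptional \<open>z\<close> (the map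
  \<open>(a, b) \<mapsto> (a\<^sub>i - b\<^sub>i (z + c\<^sub>i))\<^sub>i\<close> is not injective, so \<open>G(Y | z, \<cdot>)\<close> may be constant on a
  segment in \<open>A\<close>), hence a relation rather than a function of \<open>z\<close>. Whenever the minimizer at
  \<open>z\<close> is unique, \<open>\<exists>p. solves_fixed_point G c A z p\<close> is the equation for
  \<open>(a\<^sup>*(z), b\<^sup>*(z))\<close>.\<close>

definition solves_fixed_point ::
    "(real ^ 'm \<Rightarrow> real) \<Rightarrow> real ^ 'm \<Rightarrow> 'm params set \<Rightarrow> real \<Rightarrow> 'm params \<Rightarrow> bool" where
  "solves_fixed_point G c A z p \<longleftrightarrow>
     is_arg_min (G_markup G c z) (\<lambda>q. q \<in> A) p \<and>
     z = (1 + lambert_W (G_markup G c 0 p * exp (-1))) / common_value (snd p)"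

section \<open>Max-min problems\<close>

text \<open>\<open>v\<close> is the attained minimum (maximum) of \<open>f\<close> on \<open>S\<close>.\<close>

definition is_minimum :: "('s \<Rightarrow> real) \<Rightarrow> 's set \<Rightarrow> real \<Rightarrow> bool" where
  "is_minimum f S v \<longleftrightarrow> v \<in> f ` S \<and> (\<forall>s\<in>S. v \<le> f s)"

definition is_maximum :: "('s \<Rightarrow> real) \<Rightarrow> 's set \<Rightarrow> real \<Rightarrow> bool" where
  "is_maximum f S v \<longleftrightarrow> v \<in> f ` S \<and> (\<forall>s\<in>S. f s \<le> v)"

text \<open>In the following, \<open>f x p\<close> is to be maximized over all \<open>x\<close> and minimized over
  \<open>p \<in> A\<close>.\<close>

definition unique_maxmin_solution :: "('x \<Rightarrow> 'p \<Rightarrow> real) \<Rightarrow> 'p set \<Rightarrow> 'x \<Rightarrow> bool" where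
  "unique_maxmin_solution f A x \<longleftrightarrow>
     (\<exists>g. (\<forall>y. is_minimum (f y) A (g y)) \<and> (\<forall>y. y \<noteq> x \<longrightarrow> g y < g x))"

definition saddle_point :: "('x \<Rightarrow> 'p \<Rightarrow> real) \<Rightarrow> 'p set \<Rightarrow> 'x \<Rightarrow> 'p \<Rightarrow> bool" where
  "saddle_point f A x p \<longleftrightarrow>
     p \<in> A \<and> (\<forall>y. f y p \<le> f x p) \<and> (\<forall>q\<in>A. f x p \<le> f x q)"

definition minimax_equality :: "('x \<Rightarrow> 'p \<Rightarrow> real) \<Rightarrow> 'p set \<Rightarrow> bool" where
  "minimax_equality f A \<longleftrightarrow>
     (\<exists>g h v. (\<forall>x. is_minimum (f x) A (g x)) \<and> is_maximum g UNIV v \<and>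
              (\<forall>p\<in>A. is_maximum (\<lambda>x. f x p) UNIV (h p)) \<and> is_minimum h A v)"

end

theory Submission
  imports Defs
begin

text \<open>In terms of the utilities \<open>u\<^sub>i = a\<^sub>i - b\<^sub>i x\<^sub>i\<close>, the function \<open>F(u) = ln (1 + G(e\<^sup>u))\<close> is strictly
  convex with gradient the vector of choice probabilities. Its tangent inequality shows that, for known
  parameters with common sensitivity \<open>b\<close>, the constant markup with \<open>b z = 1 + G(Y | z)\<close> is the
  unique optimum, of profit \<open>z - 1/b\<close>. At a constant positive markup, profit is increasing in \<open>G\<close>;
  so a solution of the fixed point problem is a saddle point, and such a solution is obtained by minimizing the optimal
  profit over \<open>A\<close>.\<close>

section \<open>Partial derivatives and Euler's identities\<close>

lemma has_derivative_vec_components: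
  assumes "\<And>i. ((\<lambda>s. \<gamma> s $ i) has_real_derivative d $ i) (at s)"
  shows "(\<gamma> has_derivative (\<lambda>h. h *\<^sub>R (d :: real ^ 'm))) (at s)"
  unfolding has_derivative_componentwise_within[of \<gamma>]
  using assms by (auto simp: Basis_vec_def inner_axis has_field_derivative_def mult_commute_abs)

lemma linear_coordinate_sum:
  fixes D :: "real ^ 'm \<Rightarrow> real"
  assumes "linear D"
  shows "D h = (\<Sum>i\<in>UNIV. h $ i * D (axis i 1))"
proof -
  have "D h = D (\<Sum>i\<in>UNIV. h $ i *\<^sub>R axis i 1)"
    using basis_expansion[of h] by (simp add: scalar_mult_eq_scaleR)
  then show ?thesis by (simp add: linear_sum[OF assms] linear_cmul[OF assms])
qed

lemma has_derivative_partial_deriv: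
  fixes f :: "real ^ 'm \<Rightarrow> real"
  assumes "f differentiable (at Y)"
  shows "(f has_derivative (\<lambda>h. \<Sum>i\<in>UNIV. h $ i * partial_deriv i f Y)) (at Y)"
proof -
  obtain D where D: "(f has_derivative D) (at Y)"
    using assms by (auto simp: differentiable_def)
  then have lin: "linear D" by (rule has_derivative_linear)
  have "partial_deriv i f Y = D (axis i 1)" for i
  proof -
    have line: "((\<lambda>t. Y + t *\<^sub>R axis i 1) has_derivative (\<lambda>t. t *\<^sub>R axis i 1)) (at 0)"
      by (auto intro!: derivative_eq_intros)
    have "((\<lambda>t. f (Y + t *\<^sub>R axis i 1)) has_derivative (\<lambda>t. D (t *\<^sub>R axis i 1))) (at 0)"
      using has_derivative_compose[OF line, of f D] D by simp
    then have "((\<lambda>t. f (Y + t *\<^sub>R axis i 1)) has_real_derivative D (axis i 1)) (at 0)"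
      by (simp add: has_field_derivative_def linear_cmul[OF lin] mult_commute_abs)
    then show ?thesis by (simp add: partial_deriv_def DERIV_imp_deriv)
  qed
  with D show ?thesis using linear_coordinate_sum[OF lin] by (metis (no_types, lifting) ext sum.cong)
qed

text \<open>The chain rule in coordinates. Along rays it yields Euler's identities; along
  exponentials of a segment it yields convexity.\<close>

lemma DERIV_along_curve:
  fixes f :: "real ^ 'm \<Rightarrow> real"
  assumes "f differentiable (at (\<gamma> s))"
    and "\<And>i. ((\<lambda>s. \<gamma> s $ i) has_real_derivative d i) (at s)"
  shows "((\<lambda>s. f (\<gamma> s)) has_real_derivative (\<Sum>i\<in>UNIV. d i * partial_deriv i f (\<gamma> s))) (at s)"
proof -
  have "(\<gamma> has_derivative (\<lambda>h. h *\<^sub>R (\<chi> i. d i))) (at s)"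
    by (rule has_derivative_vec_components) (simp add: assms(2))
  from has_derivative_compose[OF this has_derivative_partial_deriv[OF assms(1)]]
  show ?thesis
    by (simp add: has_field_derivative_def mult.assoc mult_commute_abs flip: sum_distrib_left)
qed

lemma partial_deriv_DERIV:
  fixes f :: "real ^ 'm \<Rightarrow> real"
  assumes "f differentiable (at Y)"
  shows "((\<lambda>t. f (Y + t *\<^sub>R axis i 1)) has_real_derivative partial_deriv i f Y) (at 0)"
proof -
  have "((\<lambda>t. f (Y + t *\<^sub>R axis i 1)) has_real_derivative
      (\<Sum>j\<in>UNIV. axis i 1 $ j * partial_deriv j f (Y + 0 *\<^sub>R axis i 1))) (at 0)"
    by (rule DERIV_along_curve) (use assms in \<open>auto intro!: derivative_eq_intros\<close>)
  moreover have "(\<Sum>j\<in>UNIV. axis i 1 $ j * partial_deriv j f Y)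
      = (\<Sum>j\<in>UNIV. if j = i then partial_deriv i f Y else 0)"
    by (rule sum.cong) (auto simp: axis_def)
  ultimately show ?thesis by simp
qed

lemma open_pos_orthant: "open (pos_orthant :: (real ^ 'm) set)"
proof -
  have "pos_orthant = (\<Inter>i. {Y :: real ^ 'm. 0 < Y $ i})"
    by (auto simp: pos_orthant_def)
  moreover have "open (\<Inter>i. {Y :: real ^ 'm. 0 < Y $ i})"
    by (intro open_INT finite_class.finite_UNIV ballI open_Collect_less continuous_intros)
  ultimately show ?thesis by simp
qed

text \<open>The properties of \<open>G\<close> hold on the orthant only; this is what allows
  identities valid there to be differentiated along a line at 0.\<close>

lemma eventually_pos_orthant_line:
  assumes "Y \<in> pos_orthant"
  shows "eventually (\<lambda>t. Y + t *\<^sub>R v \<in> pos_orthant) (nhds (0 :: real))"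
proof -
  have "open ((\<lambda>t. Y + t *\<^sub>R v) -` pos_orthant)"
    by (intro open_vimage open_pos_orthant continuous_intros)
  then show ?thesis
    using assms by (auto simp: eventually_nhds intro!: exI[of _ "(\<lambda>t. Y + t *\<^sub>R v) -` pos_orthant"])
qed

section \<open>Homogeneity and Euler's identities for a GEV function\<close>

context
  fixes G :: "real ^ 'm \<Rightarrow> real"
  assumes G: "GEV_CPGF G"
begin

lemma GEV_differentiable:
  assumes "Y \<in> pos_orthant"
  shows "mixed_partial ks G differentiable (at Y)"
  using G assms by (auto simp: GEV_CPGF_def smooth_on_orthant_def)

lemma GEV_diff0: "Y \<in> pos_orthant \<Longrightarrow> G differentiable (at Y)"
  using GEV_differentiable[of Y "[]"] by simp

lemma GEV_diff1: "Y \<in> pos_orthant \<Longrightarrow> partial_deriv i G differentiable (at Y)"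
  using GEV_differentiable[of Y "[i]"] by simp

lemma GEV_homogeneous: "Y \<in> pos_orthant \<Longrightarrow> l > 0 \<Longrightarrow> G (l *\<^sub>R Y) = l * G Y"
  using G by (auto simp: GEV_CPGF_def)

lemma GEV_partial_pos: "Y \<in> pos_orthant \<Longrightarrow> 0 < partial_deriv i G Y"
  using G unfolding GEV_CPGF_def by (auto dest!: spec[of _ "[i]"])

lemma GEV_partial2_nonpos:
  "Y \<in> pos_orthant \<Longrightarrow> i \<noteq> j \<Longrightarrow> partial_deriv i (partial_deriv j G) Y \<le> 0"
  using G unfolding GEV_CPGF_def by (auto dest!: spec[of _ "[i, j]"])

text \<open>Differentiate \<open>G (l *\<^sub>R (Y + t *\<^sub>R axis i 1))\<close> at
  \<open>t = 0\<close>, once by the chain rule and once after pulling out \<open>l\<close>; the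
  factor \<open>l\<close> cancels.\<close>

lemma GEV_partial_homogeneous:
  assumes Y: "Y \<in> pos_orthant" and l: "l > 0"
  shows "partial_deriv i G (l *\<^sub>R Y) = partial_deriv i G Y"
proof -
  have lY: "l *\<^sub>R Y \<in> pos_orthant" using Y l by (auto simp: pos_orthant_def)
  have "((\<lambda>t. G (l *\<^sub>R Y + (l * t) *\<^sub>R axis i 1)) has_real_derivative
      partial_deriv i G (l *\<^sub>R Y) * l) (at 0)"
    by (rule DERIV_chain2[where g = "\<lambda>t. l * t"])
       (use partial_deriv_DERIV[OF GEV_diff0[OF lY]] in \<open>auto intro!: derivative_eq_intros\<close>)
  moreover have "eventually (\<lambda>t. G (l *\<^sub>R Y + (l * t) *\<^sub>R axis i 1)
      = l * G (Y + t *\<^sub>R axis i 1)) (nhds 0)"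
    using eventually_pos_orthant_line[OF Y, of "axis i 1"]
    by eventually_elim (use GEV_homogeneous l in \<open>simp flip: scaleR_scaleR scaleR_add_right\<close>)
  ultimately have "((\<lambda>t. l * G (Y + t *\<^sub>R axis i 1)) has_real_derivative
      partial_deriv i G (l *\<^sub>R Y) * l) (at 0)"
    by (subst (asm) DERIV_cong_ev[OF refl _ refl]) auto
  moreover have "((\<lambda>t. l * G (Y + t *\<^sub>R axis i 1)) has_real_derivative
      l * partial_deriv i G Y) (at 0)"
    by (intro DERIV_cmult partial_deriv_DERIV GEV_diff0 Y)
  ultimately show ?thesis using DERIV_unique l by fastforce
qed

text \<open>Both sides are the derivative of \<open>G (l *\<^sub>R Y) = l * G Y\<close> at
  \<open>l = 1\<close>.\<close>

lemma Euler_identity: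
  assumes Y: "Y \<in> pos_orthant"
  shows "(\<Sum>i\<in>UNIV. Y $ i * partial_deriv i G Y) = G Y"
proof -
  have "((\<lambda>l. G (l *\<^sub>R Y)) has_real_derivative
      (\<Sum>i\<in>UNIV. Y $ i * partial_deriv i G (1 *\<^sub>R Y))) (at 1)"
    by (rule DERIV_along_curve) (use Y in \<open>auto intro!: derivative_eq_intros GEV_diff0\<close>)
  moreover have "eventually (\<lambda>l. G (l *\<^sub>R Y) = l * G Y) (nhds 1)"
    using eventually_nhds_in_open[of "{0<..}" "1::real"]
    by (auto elim!: eventually_mono intro!: GEV_homogeneous Y)
  ultimately have "((\<lambda>l. l * G Y) has_real_derivative
      (\<Sum>i\<in>UNIV. Y $ i * partial_deriv i G Y)) (at 1)"
    by (subst (asm) DERIV_cong_ev[OF refl _ refl]) auto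
  moreover have "((\<lambda>l. l * G Y) has_real_derivative G Y) (at 1)"
    by (auto intro!: derivative_eq_intros)
  ultimately show ?thesis by (rule DERIV_unique)
qed

text \<open>The axiom gives only nonnegativity. Euler's identity writes \<open>G Y\<close> as a
  nonempty sum of positive terms.\<close>

lemma GEV_pos: "Y \<in> pos_orthant \<Longrightarrow> 0 < G Y"
  by (subst Euler_identity[symmetric])
     (auto intro!: sum_pos mult_pos_pos GEV_partial_pos simp: pos_orthant_def)

text \<open>First partials are homogeneous of degree 0, so they are constant along rays.\<close>

lemma Euler_partial:
  assumes Y: "Y \<in> pos_orthant"
  shows "(\<Sum>j\<in>UNIV. Y $ j * partial_deriv j (partial_deriv i G) Y) = 0"
proof -
  have "((\<lambda>l. partial_deriv i G (l *\<^sub>R Y)) has_real_derivative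
      (\<Sum>j\<in>UNIV. Y $ j * partial_deriv j (partial_deriv i G) (1 *\<^sub>R Y))) (at 1)"
    by (rule DERIV_along_curve) (use Y in \<open>auto intro!: derivative_eq_intros GEV_diff1\<close>)
  moreover have "eventually (\<lambda>l. partial_deriv i G (l *\<^sub>R Y) = partial_deriv i G Y) (nhds 1)"
    using eventually_nhds_in_open[of "{0<..}" "1::real"]
    by (auto elim!: eventually_mono intro!: GEV_partial_homogeneous Y)
  ultimately have "((\<lambda>l::real. partial_deriv i G Y) has_real_derivative
      (\<Sum>j\<in>UNIV. Y $ j * partial_deriv j (partial_deriv i G) Y)) (at 1)"
    by (subst (asm) DERIV_cong_ev[OF refl _ refl]) auto
  then show ?thesis using DERIV_const DERIV_unique by blast
qed

text \<open>Differentiating Euler's identity itself gives the other marginal sums, so that symmetry of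
  second derivatives is not required.\<close>

lemma Euler_partial_transposed:
  assumes Y: "Y \<in> pos_orthant"
  shows "(\<Sum>i\<in>UNIV. Y $ i * partial_deriv j (partial_deriv i G) Y) = 0"
proof -
  let ?L = "\<lambda>t. Y + t *\<^sub>R axis j 1"
  have "((\<lambda>t. \<Sum>i\<in>UNIV. ?L t $ i * partial_deriv i G (?L t)) has_real_derivative
     (\<Sum>i\<in>UNIV. axis j 1 $ i * partial_deriv i G Y
        + Y $ i * partial_deriv j (partial_deriv i G) Y)) (at 0)"
  proof (rule DERIV_sum)
    fix i
    have "((\<lambda>t. ?L t $ i) has_real_derivative axis j 1 $ i) (at 0)"
      by (auto intro!: derivative_eq_intros)
    from DERIV_mult[OF this partial_deriv_DERIV[OF GEV_diff1[OF Y], of i j]]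
    show "((\<lambda>t. ?L t $ i * partial_deriv i G (?L t)) has_real_derivative
        axis j 1 $ i * partial_deriv i G Y
          + Y $ i * partial_deriv j (partial_deriv i G) Y) (at 0)"
      by (simp add: mult_ac)
  qed
  moreover have "eventually (\<lambda>t. (\<Sum>i\<in>UNIV. ?L t $ i * partial_deriv i G (?L t)) = G (?L t)) (nhds 0)"
    using eventually_pos_orthant_line[OF Y] by eventually_elim (rule Euler_identity)
  ultimately have "((\<lambda>t. G (?L t)) has_real_derivative
     (\<Sum>i\<in>UNIV. axis j 1 $ i * partial_deriv i G Y
        + Y $ i * partial_deriv j (partial_deriv i G) Y)) (at 0)"
    by (subst (asm) DERIV_cong_ev[OF refl _ refl]) auto
  then have "(\<Sum>i\<in>UNIV. axis j 1 $ i * partial_deriv i G Y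
        + Y $ i * partial_deriv j (partial_deriv i G) Y) = partial_deriv j G Y"
    using partial_deriv_DERIV[OF GEV_diff0[OF Y]] by (rule DERIV_unique)
  moreover have "(\<Sum>i\<in>UNIV. axis j 1 $ i * partial_deriv i G Y)
      = (\<Sum>i\<in>UNIV. if i = j then partial_deriv j G Y else 0)"
    by (rule sum.cong) (auto simp: axis_def)
  ultimately show ?thesis by (simp add: sum.distrib)
qed

end

section \<open>Strict convexity of the log-partition function\<close>

text \<open>\<open>M\<close> behaves like a graph Laplacian: in the sum of
  \<open>M i j * (d i - d j)\<^sup>2\<close> the pure squares vanish by the zero marginals, leaving
  -2 times the form, while every term is nonpositive.\<close>

lemma quadratic_form_nonneg_of_zero_marginals:
  fixes M :: "'m::finite \<Rightarrow> 'm \<Rightarrow> real"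
  assumes "\<And>i. (\<Sum>j\<in>UNIV. M i j) = 0" and "\<And>j. (\<Sum>i\<in>UNIV. M i j) = 0"
    and "\<And>i j. i \<noteq> j \<Longrightarrow> M i j \<le> 0"
  shows "0 \<le> (\<Sum>i\<in>UNIV. \<Sum>j\<in>UNIV. M i j * d i * d j)"
proof -
  have "(\<Sum>i\<in>UNIV. \<Sum>j\<in>UNIV. M i j * (d i - d j)\<^sup>2)
      = (\<Sum>i\<in>UNIV. \<Sum>j\<in>UNIV. (d i)\<^sup>2 * M i j) + (\<Sum>i\<in>UNIV. \<Sum>j\<in>UNIV. (d j)\<^sup>2 * M i j)
        - 2 * (\<Sum>i\<in>UNIV. \<Sum>j\<in>UNIV. M i j * d i * d j)"
    unfolding sum_distrib_left sum.distrib[symmetric] sum_subtractf[symmetric]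
    by (intro sum.cong refl) (simp add: power2_eq_square algebra_simps)
  also have "(\<Sum>i\<in>UNIV. \<Sum>j\<in>UNIV. (d i)\<^sup>2 * M i j) = 0"
    by (simp flip: sum_distrib_left add: assms)
  also have "(\<Sum>i\<in>UNIV. \<Sum>j\<in>UNIV. (d j)\<^sup>2 * M i j) = 0"
    by (subst sum.swap) (simp flip: sum_distrib_left add: assms)
  finally have "2 * (\<Sum>i\<in>UNIV. \<Sum>j\<in>UNIV. M i j * d i * d j)
      = - (\<Sum>i\<in>UNIV. \<Sum>j\<in>UNIV. M i j * (d i - d j)\<^sup>2)" by simp
  moreover have "M i j * (d i - d j)\<^sup>2 \<le> 0" for i j
    using assms(3)[of i j] by (cases "i = j") (auto intro: mult_nonpos_nonneg)
  then have "(\<Sum>i\<in>UNIV. \<Sum>j\<in>UNIV. M i j * (d i - d j)\<^sup>2) \<le> 0"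
    by (intro sum_nonpos)
  ultimately show ?thesis by linarith
qed

text \<open>Cauchy-Schwarz bounds the left side by the total mass times the second moment. The
  missing mass makes the inequality strict, even for constant \<open>d\<close>.\<close>

lemma subprobability_variance_pos:
  fixes P :: "'m::finite \<Rightarrow> real"
  assumes P: "\<And>i. 0 < P i" and "(\<Sum>i\<in>UNIV. P i) < 1" and "d k \<noteq> 0"
  shows "(\<Sum>i\<in>UNIV. P i * d i)\<^sup>2 < (\<Sum>i\<in>UNIV. P i * (d i)\<^sup>2)"
proof -
  let ?q = "\<Sum>i\<in>UNIV. P i" and ?S = "\<Sum>i\<in>UNIV. P i * (d i)\<^sup>2"
  have "(\<Sum>i\<in>UNIV. sqrt (P i) * (sqrt (P i) * d i))\<^sup>2
      \<le> (\<Sum>i\<in>UNIV. (sqrt (P i))\<^sup>2) * (\<Sum>i\<in>UNIV. (sqrt (P i) * d i)\<^sup>2)"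
    by (rule Cauchy_Schwarz_ineq_sum)
  then have "(\<Sum>i\<in>UNIV. P i * d i)\<^sup>2 \<le> ?q * ?S"
    using P by (simp add: power_mult_distrib less_imp_le flip: mult.assoc)
  also have "\<dots> < ?S"
  proof -
    have "0 < ?S"
      using assms(3) P[of k] by (intro sum_pos2[of _ k]) (auto simp: less_imp_le[OF P])
    then show ?thesis using assms(2) by simp
  qed
  finally show ?thesis .
qed

definition exp_vec :: "real ^ 'm \<Rightarrow> real ^ 'm" where
  "exp_vec u = (\<chi> i. exp (u $ i))"

lemma exp_vec_pos [simp]: "exp_vec u \<in> pos_orthant"
  by (simp add: exp_vec_def pos_orthant_def)

text \<open>If \<open>G\<close> sums the coordinates (multinomial logit), this is log-sum-exp with
  an outside option of utility 0.\<close>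

definition log_partition :: "(real ^ 'm \<Rightarrow> real) \<Rightarrow> real ^ 'm \<Rightarrow> real" where
  "log_partition G u = ln (1 + G (exp_vec u))"

lemma sum_choice_prob:
  assumes G: "GEV_CPGF G" and "Y \<in> pos_orthant"
  shows "(\<Sum>i\<in>UNIV. choice_prob G Y i) = G Y / (1 + G Y)"
  using Euler_identity[OF assms] by (simp add: choice_prob_def flip: sum_divide_distrib)

text \<open>The gradient of the log-partition function is the vector of choice probabilities, and its
  Hessian is a covariance-like matrix plus a matrix with nonpositive off-diagonal entries and
  vanishing marginals.\<close>

lemma log_partition_gradient_strict:
  assumes G: "GEV_CPGF G" and "u \<noteq> v"
  shows "log_partition G u + (\<Sum>i\<in>UNIV. choice_prob G (exp_vec u) i * (v $ i - u $ i))
    < log_partition G v"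
proof -
  define d where "d i = v $ i - u $ i" for i
  define Y where "Y s = exp_vec (u + s *\<^sub>R (v - u))" for s :: real
  \<comment> \<open>\<open>N\<close> is the derivative of \<open>G\<close> along the curve
    \<open>Y\<close>; \<open>M\<close> is the Hessian of \<open>G\<close> with row \<open>i\<close>
    and column \<open>j\<close> scaled by the coordinates of \<open>Y s\<close>.\<close>
  define N where "N s = (\<Sum>i\<in>UNIV. Y s $ i * d i * partial_deriv i G (Y s))" for s
  define M where "M s i j = Y s $ i * Y s $ j * partial_deriv j (partial_deriv i G) (Y s)" for s i j
  obtain k where k: "d k \<noteq> 0" using \<open>u \<noteq> v\<close> by (metis d_def eq_iff_diff_eq_0 vec_eq_iff)
  have pos: "Y s \<in> pos_orthant" for s by (simp add: Y_def)
  then have Yi: "0 < Y s $ i" for s i by (simp add: pos_orthant_def)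
  have Gpos: "0 < G (Y s)" for s by (rule GEV_pos[OF G pos])
  have dY: "((\<lambda>s. Y s $ i) has_real_derivative Y s $ i * d i) (at s)" for i s
    unfolding Y_def exp_vec_def d_def by (auto intro!: derivative_eq_intros)
  have dG: "((\<lambda>s. G (Y s)) has_real_derivative N s) (at s)" for s
    using DERIV_along_curve[OF GEV_diff0[OF G pos] dY] by (simp add: N_def)
  have dP: "((\<lambda>s. partial_deriv i G (Y s)) has_real_derivative
      (\<Sum>j\<in>UNIV. Y s $ j * d j * partial_deriv j (partial_deriv i G) (Y s))) (at s)" for i s
    by (rule DERIV_along_curve[OF GEV_diff1[OF G pos] dY])
  have dN: "(N has_real_derivative (\<Sum>i\<in>UNIV. Y s $ i * partial_deriv i G (Y s) * (d i)\<^sup>2)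
      + (\<Sum>i\<in>UNIV. \<Sum>j\<in>UNIV. M s i j * d i * d j)) (at s)" for s
    unfolding N_def sum.distrib[symmetric]
  proof (rule DERIV_sum)
    fix i
    have "((\<lambda>s. Y s $ i * d i * partial_deriv i G (Y s)) has_real_derivative
        (Y s $ i * d i * d i) * partial_deriv i G (Y s)
          + (\<Sum>j\<in>UNIV. Y s $ j * d j * partial_deriv j (partial_deriv i G) (Y s))
            * (Y s $ i * d i)) (at s)"
      by (intro DERIV_mult dP DERIV_cmult_right dY)
    then show "((\<lambda>s. Y s $ i * d i * partial_deriv i G (Y s)) has_real_derivative
        Y s $ i * partial_deriv i G (Y s) * (d i)\<^sup>2 + (\<Sum>j\<in>UNIV. M s i j * d i * d j)) (at s)"
      by (simp add: M_def sum_distrib_left power2_eq_square mult_ac)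
  qed
  define g where "g s = log_partition G (u + s *\<^sub>R (v - u))" for s
  define g' where "g' = (\<lambda>s. N s / (1 + G (Y s)))"
  have dg: "(g has_real_derivative g' s) (at s)" for s
    unfolding g_def g'_def log_partition_def Y_def[symmetric]
    using Gpos[of s] by (auto intro!: derivative_eq_intros dG)
  have g'_mono: "g' 0 < g' t" if "0 < t" for t
  proof (rule DERIV_pos_imp_increasing[OF that])
    fix s :: real
    let ?Q = "1 + G (Y s)"
    let ?S = "\<Sum>i\<in>UNIV. Y s $ i * partial_deriv i G (Y s) * (d i)\<^sup>2"
    let ?B = "\<Sum>i\<in>UNIV. \<Sum>j\<in>UNIV. M s i j * d i * d j"
    have Q: "0 < ?Q" using Gpos[of s] by simp
    have "0 \<le> ?B"
    proof (rule quadratic_form_nonneg_of_zero_marginals)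
      show "(\<Sum>j\<in>UNIV. M s i j) = 0" for i
        using Euler_partial[OF G pos] by (simp add: M_def mult.assoc flip: sum_distrib_left)
      have "(\<Sum>i\<in>UNIV. M s i j) = Y s $ j * (\<Sum>i\<in>UNIV. Y s $ i * partial_deriv j (partial_deriv i G) (Y s))" for j
        by (simp add: M_def sum_distrib_left mult_ac)
      then show "(\<Sum>i\<in>UNIV. M s i j) = 0" for j
        using Euler_partial_transposed[OF G pos] by simp
      show "M s i j \<le> 0" if "i \<noteq> j" for i j
        using GEV_partial2_nonpos[OF G pos, of j i s] that Yi[of s i] Yi[of s j]
        by (auto simp: M_def intro!: mult_nonneg_nonpos)
    qed
    \<comment> \<open>Division by \<open>?Q\<close> turns the weights into choice probabilities,
      whose sum is below 1.\<close>
    moreover have "(N s / ?Q)\<^sup>2 < ?S / ?Q"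
    proof -
      have "(\<Sum>i\<in>UNIV. choice_prob G (Y s) i * d i)\<^sup>2 < (\<Sum>i\<in>UNIV. choice_prob G (Y s) i * (d i)\<^sup>2)"
      proof (rule subprobability_variance_pos[where k = k])
        show "0 < choice_prob G (Y s) i" for i
          using Yi[of s i] Q GEV_partial_pos[OF G pos] by (simp add: choice_prob_def)
        show "(\<Sum>i\<in>UNIV. choice_prob G (Y s) i) < 1"
          using Q by (simp add: sum_choice_prob[OF G pos])
        show "d k \<noteq> 0" by (rule k)
      qed
      then show ?thesis
        by (simp add: choice_prob_def N_def sum_divide_distrib mult_ac)
    qed
    ultimately have "0 < (?S + ?B) / ?Q - (N s / ?Q)\<^sup>2"
      using Q by (simp add: add_divide_distrib) (smt (verit) divide_nonneg_pos)
    moreover have "(g' has_real_derivative (?S + ?B) / ?Q - (N s / ?Q)\<^sup>2) (at s)"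
    proof -
      have "((\<lambda>s. 1 + G (Y s)) has_real_derivative N s) (at s)"
        using DERIV_add[OF DERIV_const dG] by simp
      from DERIV_divide[OF dN this]
      have "(g' has_real_derivative ((?S + ?B) * ?Q - N s * N s) / (?Q * ?Q)) (at s)"
        using Q by (simp add: g'_def)
      also have "((?S + ?B) * ?Q - N s * N s) / (?Q * ?Q) = (?S + ?B) / ?Q - (N s / ?Q)\<^sup>2"
        using Q by (simp add: diff_divide_distrib power2_eq_square)
      finally show ?thesis .
    qed
    ultimately show "\<exists>y. (g' has_real_derivative y) (at s) \<and> 0 < y" by blast
  qed
  \<comment> \<open>The mean value theorem gives a slope at an interior point, which exceeds the
    slope at 0.\<close>
  obtain t where t: "0 < t" "g 1 - g 0 = (1 - 0) * g' t"
    using MVT2[of 0 1 g g'] dg by auto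
  have "g' 0 = (\<Sum>i\<in>UNIV. choice_prob G (exp_vec u) i * (v $ i - u $ i))"
    by (simp add: g'_def N_def Y_def d_def choice_prob_def sum_divide_distrib mult_ac)
  then show ?thesis using t g'_mono[OF t(1)] by (simp add: g_def)
qed

text \<open>Take the tangent at the intermediate point \<open>w\<close>. The directions to
  \<open>u\<close> and \<open>v\<close> are opposite, so the linear term is nonnegative towards one
  of them, and that end has a strictly larger value.\<close>

lemma G_exp_vec_strict_quasiconvex:
  assumes G: "GEV_CPGF G" and "u \<noteq> v" and t: "0 < t" "t < 1"
  shows "G (exp_vec ((1 - t) *\<^sub>R u + t *\<^sub>R v)) < max (G (exp_vec u)) (G (exp_vec v))"
proof -
  define w where "w = (1 - t) *\<^sub>R u + t *\<^sub>R v"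
  define S where "S = (\<Sum>i\<in>UNIV. choice_prob G (exp_vec w) i * (v $ i - u $ i))"
  have uw: "u - w = - t *\<^sub>R (v - u)" and vw: "v - w = (1 - t) *\<^sub>R (v - u)"
    by (simp_all add: w_def algebra_simps)
  then have "w \<noteq> u" "w \<noteq> v" using assms by auto
  then have "log_partition G w + (\<Sum>i\<in>UNIV. choice_prob G (exp_vec w) i * (u - w) $ i) < log_partition G u"
      "log_partition G w + (\<Sum>i\<in>UNIV. choice_prob G (exp_vec w) i * (v - w) $ i) < log_partition G v"
    using log_partition_gradient_strict[OF G] by auto
  moreover have "(\<Sum>i\<in>UNIV. choice_prob G (exp_vec w) i * (u - w) $ i) = - t * S"
      "(\<Sum>i\<in>UNIV. choice_prob G (exp_vec w) i * (v - w) $ i) = (1 - t) * S"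
    by (simp_all add: uw vw S_def sum_distrib_left mult_ac sum_negf)
  ultimately have "log_partition G w - t * S < log_partition G u"
      "log_partition G w + (1 - t) * S < log_partition G v" by simp_all
  moreover have "0 \<le> (1 - t) * S \<or> 0 \<le> - t * S"
    using t by (cases "0 \<le> S") (auto simp: mult_le_0_iff zero_le_mult_iff)
  ultimately have "log_partition G w < log_partition G u \<or> log_partition G w < log_partition G v"
    by linarith
  moreover have "0 < G (exp_vec y)" for y by (rule GEV_pos[OF G exp_vec_pos])
  ultimately show ?thesis
    by (auto simp: log_partition_def less_max_iff_disj add_pos_pos simp flip: w_def)
qed

section \<open>The Lambert W function on the nonnegative reals\<close>

text \<open>The map \<open>w * exp w\<close> is expanding on the nonnegative reals. This gives both
  uniqueness of its inverse there and the Lipschitz constant 1.\<close>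

lemma mult_exp_diff_ge:
  fixes v w :: real
  assumes "0 \<le> v" "v \<le> w"
  shows "w - v \<le> w * exp w - v * exp v"
proof -
  have "w - v \<le> (w - v) * exp w" using assms by (simp add: mult_le_cancel_left1)
  also have "\<dots> \<le> w * exp w - v * exp v"
    using assms mult_left_mono[of "exp v" "exp w" v] by (simp add: algebra_simps)
  finally show ?thesis .
qed

lemma lambert_W_unique:
  assumes "0 \<le> w" "w * exp w = y"
  shows "lambert_W y = w"
  unfolding lambert_W_def
proof (rule the_equality)
  show "-1 \<le> w \<and> w * exp w = y" using assms by simp
  fix v :: real
  assume v: "-1 \<le> v \<and> v * exp v = y"
  \<comment> \<open>The definition admits candidates down to -1; a nonnegative \<open>y\<close>
    rules out the negative ones.\<close>
  have "0 \<le> y" using assms by auto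
  then have "0 \<le> v * exp v" using v by simp
  then have "0 \<le> v" by (simp add: zero_le_mult_iff)
  then show "v = w"
    using mult_exp_diff_ge[of v w] mult_exp_diff_ge[of w v] assms v by linarith
qed

lemma lambert_W:
  assumes "0 \<le> y"
  shows "0 \<le> lambert_W y" and "lambert_W y * exp (lambert_W y) = y"
proof -
  have "y \<le> y * exp y" using assms by (simp add: mult_le_cancel_left1)
  then obtain w where "0 \<le> w" "w * exp w = y"
    using IVT'[of "\<lambda>w. w * exp w" 0 y y] assms by (force intro!: continuous_intros)
  then show "0 \<le> lambert_W y" "lambert_W y * exp (lambert_W y) = y"
    using lambert_W_unique by auto
qed

lemma continuous_on_lambert_W: "continuous_on {0..} lambert_W"
proof -
  have "dist (lambert_W x) (lambert_W y) \<le> 1 * dist x y" if "0 \<le> x" "0 \<le> y" for x y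
    using mult_exp_diff_ge[of "lambert_W x" "lambert_W y"] mult_exp_diff_ge[of "lambert_W y" "lambert_W x"]
      lambert_W[OF that(1)] lambert_W[OF that(2)]
    unfolding dist_real_def by argo
  then have "1-lipschitz_on {0..} lambert_W" by (auto intro!: lipschitz_onI)
  then show ?thesis by (rule lipschitz_on_continuous_on)
qed

section \<open>Optimal prices for known parameters\<close>

definition uniform_sensitivity :: "'m::finite params \<Rightarrow> bool" where
  "uniform_sensitivity p \<longleftrightarrow>
     (\<forall>i j. snd p $ i = snd p $ j) \<and> (\<forall>i. 0 < snd p $ i)"

lemma common_value_component:
  assumes "\<forall>i j. b $ i = b $ j"
  shows "common_value b = b $ k"
  unfolding common_value_def by (rule the_equality) (use assms in auto)

lemma uniform_sensitivity_component:
  "uniform_sensitivity p \<Longrightarrow> snd p $ k = common_value (snd p)"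
  by (metis common_value_component uniform_sensitivity_def)

lemma uniform_sensitivity_pos: "uniform_sensitivity p \<Longrightarrow> 0 < common_value (snd p)"
  by (metis uniform_sensitivity_component uniform_sensitivity_def)

definition utility :: "real ^ 'm \<Rightarrow> 'm params \<Rightarrow> real ^ 'm" where
  "utility x p = (\<chi> i. fst p $ i - snd p $ i * x $ i)"

lemma attraction_eq: "attraction x p = exp_vec (utility x p)"
  by (simp add: attraction_def exp_vec_def utility_def)

lemma attraction_pos [simp]: "attraction x p \<in> pos_orthant"
  by (simp add: attraction_eq)

lemma utility_affine:
  "utility x ((1 - t) *\<^sub>R p + t *\<^sub>R q) = (1 - t) *\<^sub>R utility x p + t *\<^sub>R utility x q"
  by (simp add: utility_def vec_eq_iff algebra_simps)

lemma continuous_on_attraction [continuous_intros]: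
  assumes "continuous_on S f" "continuous_on S g"
  shows "continuous_on S (\<lambda>s. attraction (f s) (g s))"
  unfolding attraction_def by (intro continuous_intros assms)

text \<open>The closed-form root of the first-order condition b z = 1 + G(Y | z). The fixed point
  problem asks for \<open>p\<close> to minimize G at its own optimal markup.\<close>

definition optimal_markup :: "(real ^ 'm \<Rightarrow> real) \<Rightarrow> real ^ 'm \<Rightarrow> 'm params \<Rightarrow> real" where
  "optimal_markup G c p = (1 + lambert_W (G_markup G c 0 p * exp (-1))) / common_value (snd p)"

definition optimal_profit :: "(real ^ 'm \<Rightarrow> real) \<Rightarrow> real ^ 'm \<Rightarrow> 'm params \<Rightarrow> real" where
  "optimal_profit G c p = optimal_markup G c p - 1 / common_value (snd p)"

text \<open>The list \<open>ks\<close> covers \<open>G\<close> itself (\<open>[]\<close>) and its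
  first partials (\<open>[i]\<close>) at once; the profit involves both.\<close>

lemma continuous_on_GEV_attraction:
  assumes G: "GEV_CPGF G" and "continuous_on S f" "continuous_on S g"
  shows "continuous_on S (\<lambda>s. mixed_partial ks G (attraction (f s) (g s)))"
proof (rule continuous_on_compose2[of pos_orthant])
  show "continuous_on pos_orthant (mixed_partial ks G)"
    using GEV_differentiable[OF G]
    by (intro differentiable_imp_continuous_on)
       (auto simp: differentiable_on_def intro: differentiable_at_withinI)
qed (auto intro!: continuous_intros assms)

lemma saddle_worst_case:
  assumes "saddle_point f A x p" "is_minimum (f x) A v"
  shows "v = f x p"
  using assms by (auto simp: saddle_point_def is_minimum_def intro: antisym)

section \<open>First-order condition and optimality for fixed parameters\<close>

context
  fixes G :: "real ^ 'm \<Rightarrow> real" and c :: "real ^ 'm"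
  assumes G: "GEV_CPGF G"
begin

lemma G_markup_pos: "0 < G_markup G c z p"
  by (simp add: G_markup_def GEV_pos[OF G])

lemma continuous_on_G_markup:
  "continuous_on S f \<Longrightarrow> continuous_on S g \<Longrightarrow> continuous_on S (\<lambda>s. G_markup G c (f s) (g s))"
  unfolding G_markup_def markup_price_def
  by (rule continuous_on_GEV_attraction[OF G, where ks = "[]", simplified]) (auto intro!: continuous_intros)

lemma continuous_on_profit: "continuous_on S (profit G c x)"
proof -
  have "continuous_on S (\<lambda>p. G (attraction x p))" "continuous_on S (\<lambda>p. partial_deriv i G (attraction x p))" for i
    using continuous_on_GEV_attraction[OF G, of S "\<lambda>_. x" "\<lambda>p. p" "[]"]
      continuous_on_GEV_attraction[OF G, of S "\<lambda>_. x" "\<lambda>p. p" "[i]"] by auto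
  moreover have "1 + G (attraction x p) \<noteq> 0" for p
    using GEV_pos[OF G attraction_pos, of x p] by linarith
  ultimately show ?thesis
    unfolding profit_def choice_prob_def by (auto intro!: continuous_intros)
qed

text \<open>A common margin factors out of the profit, which then depends on \<open>p\<close> only
  through the value of \<open>G\<close>.\<close>

lemma profit_markup_price:
  "profit G c (markup_price c z) p = z * (G_markup G c z p / (1 + G_markup G c z p))"
  by (simp add: profit_def markup_price_def G_markup_def sum_choice_prob[OF G] flip: sum_distrib_left)

lemma optimal_markup_pos: "uniform_sensitivity p \<Longrightarrow> 0 < optimal_markup G c p"
  using lambert_W(1)[of "G_markup G c 0 p * exp (-1)"] G_markup_pos[of 0 p]
  by (simp add: optimal_markup_def uniform_sensitivity_pos divide_pos_pos)

text \<open>By homogeneity, a markup \<open>z\<close> scales \<open>G\<close> by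
  \<open>exp (- (b * z))\<close>. With \<open>b * z = 1 + w\<close> and \<open>w\<close> the Lambert
  value, this gives exactly \<open>w\<close>.\<close>

lemma optimal_markup_first_order:
  assumes p: "uniform_sensitivity p"
  shows "common_value (snd p) * optimal_markup G c p = 1 + G_markup G c (optimal_markup G c p) p"
proof -
  define b where "b = common_value (snd p)"
  define z where "z = optimal_markup G c p"
  define w where "w = lambert_W (G_markup G c 0 p * exp (-1))"
  have bz: "b * z = 1 + w"
    using uniform_sensitivity_pos[OF p] by (simp add: z_def optimal_markup_def b_def w_def)
  have "attraction (markup_price c z) p = exp (- (b * z)) *\<^sub>R attraction (markup_price c 0) p"
    using uniform_sensitivity_component[OF p]
    by (simp add: attraction_def markup_price_def vec_eq_iff b_def algebra_simps flip: exp_add)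
  then have "G_markup G c z p = exp (- (b * z)) * G_markup G c 0 p"
    by (simp add: G_markup_def GEV_homogeneous[OF G])
  also have "\<dots> = exp (- w) * (G_markup G c 0 p * exp (-1))"
    by (simp add: bz flip: exp_add)
  also have "G_markup G c 0 p * exp (-1) = w * exp w"
    using lambert_W(2)[of "G_markup G c 0 p * exp (-1)"] G_markup_pos[of 0 p] by (simp add: w_def)
  also have "exp (- w) * (w * exp w) = w" by (simp add: exp_minus)
  finally show ?thesis using bz by (simp add: b_def z_def)
qed

lemma profit_optimal_markup:
  assumes p: "uniform_sensitivity p"
  shows "profit G c (markup_price c (optimal_markup G c p)) p = optimal_profit G c p"
proof -
  define b where "b = common_value (snd p)"
  define z where "z = optimal_markup G c p"
  have b: "0 < b" using uniform_sensitivity_pos[OF p] by (simp add: b_def)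
  have g: "G_markup G c z p = b * z - 1"
    using optimal_markup_first_order[OF p] by (simp add: b_def z_def)
  have "b * z \<noteq> 0" using g G_markup_pos[of z p] by auto
  then have "profit G c (markup_price c z) p = z - 1 / b"
    using b by (simp add: profit_markup_price g field_simps)
  then show ?thesis by (simp add: optimal_profit_def b_def z_def)
qed

text \<open>With \<open>F\<close> the log-partition function, \<open>b\<close> the common sensitivity and \<open>z\<close> the optimal markup,
  the tangent inequality for \<open>F\<close> from the utility at \<open>x\<close> to that at markup \<open>z\<close> bounds \<open>b\<close> times the
  profit by \<open>k - k / s + ln (k / s)\<close>, where \<open>k = b z\<close> and \<open>s = 1 + G\<close> at \<open>x\<close>; this is at most
  \<open>k - 1\<close>.\<close>

lemma profit_less_optimal:
  assumes p: "uniform_sensitivity p" and x: "x \<noteq> markup_price c (optimal_markup G c p)"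
  shows "profit G c x p < optimal_profit G c p"
proof -
  define b where "b = common_value (snd p)"
  define z where "z = optimal_markup G c p"
  define u where "u = utility x p"
  define v where "v = utility (markup_price c z) p"
  define s where "s = 1 + G (exp_vec u)"
  have b: "0 < b" using uniform_sensitivity_pos[OF p] by (simp add: b_def)
  have s: "1 < s" using GEV_pos[OF G exp_vec_pos, of u] by (simp add: s_def)
  have Gv: "1 + G (exp_vec v) = b * z"
    using optimal_markup_first_order[OF p] by (simp add: v_def b_def z_def G_markup_def attraction_eq)
  have bz: "0 < b * z" using Gv GEV_pos[OF G exp_vec_pos, of v] by linarith
  \<comment> \<open>A common sensitivity makes utility differences affine in the margins with the
    same coefficients for all products, so the tangent term contains the profit.\<close>
  have vu: "v $ i - u $ i = b * (x $ i - c $ i) - b * z" for i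
    using uniform_sensitivity_component[OF p]
    by (simp add: v_def u_def utility_def markup_price_def b_def algebra_simps)
  have "u \<noteq> v"
  proof
    assume "u = v"
    then have "b * (x $ i - c $ i) = b * z" for i using vu[of i] by simp
    then have "x $ i - c $ i = z" for i using b by simp
    then have "x = markup_price c z" by (simp add: markup_price_def vec_eq_iff algebra_simps)
    with x show False by (simp add: z_def)
  qed
  have "(\<Sum>i\<in>UNIV. choice_prob G (exp_vec u) i * (v $ i - u $ i))
      = b * profit G c x p - b * z * (\<Sum>i\<in>UNIV. choice_prob G (exp_vec u) i)"
    unfolding vu profit_def attraction_eq u_def[symmetric] sum_distrib_left sum_subtractf[symmetric]
    by (intro sum.cong refl) (simp add: algebra_simps)
  also have "(\<Sum>i\<in>UNIV. choice_prob G (exp_vec u) i) = 1 - 1 / s"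
    using s by (simp add: sum_choice_prob[OF G] s_def field_simps)
  finally have "b * profit G c x p < b * z * (1 - 1 / s) + (ln (b * z) - ln s)"
    using log_partition_gradient_strict[OF G \<open>u \<noteq> v\<close>]
    by (simp add: log_partition_def Gv flip: s_def)
  also have "ln (b * z) - ln s \<le> b * z / s - 1"
    using ln_le_minus_one[of "b * z / s"] bz s ln_divide_pos[of "b * z" s] by simp
  finally have "b * profit G c x p < b * z - 1" by (simp add: right_diff_distrib)
  then show ?thesis using b by (simp add: optimal_profit_def field_simps flip: b_def z_def)
qed

lemma profit_le_optimal:
  assumes p: "uniform_sensitivity p"
  shows "profit G c x p \<le> optimal_profit G c p"
  using profit_less_optimal[OF p, of x] profit_optimal_markup[OF p] by fastforce

text \<open>At fixed prices the utility is affine in the parameters, so quasiconvexity in utilities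
  carries over. It is strict only where the utilities differ, as distinct parameters may share
  them.\<close>

lemma G_markup_strict_quasiconvex:
  assumes "utility (markup_price c z) p \<noteq> utility (markup_price c z) q" "0 < t" "t < 1"
  shows "G_markup G c z ((1 - t) *\<^sub>R p + t *\<^sub>R q) < max (G_markup G c z p) (G_markup G c z q)"
  using G_exp_vec_strict_quasiconvex[OF G assms]
  by (simp add: G_markup_def attraction_eq utility_affine)

lemma profit_markup_strict_mono:
  assumes "0 < z" "G_markup G c z p < G_markup G c z q"
  shows "profit G c (markup_price c z) p < profit G c (markup_price c z) q"
proof -
  have "G_markup G c z p / (1 + G_markup G c z p) < G_markup G c z q / (1 + G_markup G c z q)"
    using assms(2) G_markup_pos[of z p] G_markup_pos[of z q] by (simp add: divide_simps algebra_simps)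
  then show ?thesis using assms(1) unfolding profit_markup_price by (rule mult_strict_left_mono)
qed

lemma profit_markup_mono:
  assumes "0 < z" "G_markup G c z p \<le> G_markup G c z q"
  shows "profit G c (markup_price c z) p \<le> profit G c (markup_price c z) q"
proof (cases "G_markup G c z p = G_markup G c z q")
  case True
  then show ?thesis by (simp add: profit_markup_price)
next
  case False
  then show ?thesis using profit_markup_strict_mono[of z p q] assms by linarith
qed

section \<open>Robust pricing\<close>

context
  fixes A :: "'m params set"
  assumes A: "A \<noteq> {}" "convex A" "compact A"
    and unif: "\<And>p. p \<in> A \<Longrightarrow> uniform_sensitivity p"
begin

section \<open>Existence of a solution of the fixed point problem\<close>

lemma continuous_on_common_value: "continuous_on A (\<lambda>p. common_value (snd p))"
proof -
  \<comment> \<open>\<open>undefined\<close> serves as an arbitrary index, all entries being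
    equal.\<close>
  have "continuous_on A (\<lambda>p. snd p $ undefined)" by (intro continuous_intros)
  then show ?thesis
    by (rule continuous_on_eq) (simp add: uniform_sensitivity_component unif)
qed

lemma continuous_on_optimal_markup: "continuous_on A (optimal_markup G c)"
  unfolding optimal_markup_def
proof (intro continuous_intros continuous_on_common_value)
  show "continuous_on A (\<lambda>p. lambert_W (G_markup G c 0 p * exp (- 1)))"
    by (rule continuous_on_compose2[OF continuous_on_lambert_W])
       (auto intro!: continuous_intros continuous_on_G_markup mult_nonneg_nonneg less_imp_le[OF G_markup_pos])
qed (use uniform_sensitivity_pos unif in force)

text \<open>A minimizer \<open>p\<close> of the optimal profit solves the fixed point problem: if some \<open>q\<close> had smaller
  \<open>G\<close> at the optimal markup of \<open>p\<close>, then by continuity also at the optimal markup of a point of the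
  segment close to \<open>p\<close>, and quasiconvexity would make the optimal profit of that point smaller.\<close>

lemma ex_fixed_point: "\<exists>p. solves_fixed_point G c A (optimal_markup G c p) p"
proof -
  have "continuous_on A (optimal_profit G c)"
    unfolding optimal_profit_def
    by (intro continuous_intros continuous_on_optimal_markup continuous_on_common_value)
       (use uniform_sensitivity_pos unif in force)
  then obtain p where p: "p \<in> A" "\<And>q. q \<in> A \<Longrightarrow> optimal_profit G c p \<le> optimal_profit G c q"
    using continuous_attains_inf[OF A(3,1)] by blast
  have "\<not> G_markup G c (optimal_markup G c p) q < G_markup G c (optimal_markup G c p) p" if q: "q \<in> A" for q
  proof
    assume less: "G_markup G c (optimal_markup G c p) q < G_markup G c (optimal_markup G c p) p"
    define r where "r t = (1 - t) *\<^sub>R p + t *\<^sub>R q" for t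
    define z where "z t = optimal_markup G c (r t)" for t
    define f where "f t = G_markup G c (z t) p - G_markup G c (z t) q" for t
    have rA: "r t \<in> A" if "t \<in> {0..1}" for t
      using A(2) p(1) q that by (auto simp: r_def convex_alt)
    have "continuous_on {0..1} z"
      unfolding z_def using rA
      by (intro continuous_on_compose2[OF continuous_on_optimal_markup])
         (auto simp: r_def intro!: continuous_intros)
    then have "continuous_on {0..1} f"
      unfolding f_def by (intro continuous_intros continuous_on_G_markup)
    then have "(f \<longlongrightarrow> f 0) (at_right 0)"
      by (auto simp: continuous_on_def at_within_Icc_at_right dest: bspec[of _ _ 0])
    moreover have "0 < f 0" using less by (simp add: f_def z_def r_def)
    ultimately have "eventually (\<lambda>t. 0 < f t) (at_right 0)" by (rule order_tendstoD)
    moreover have "eventually (\<lambda>t. 0 < t \<and> t < 1) (at_right (0::real))"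
      unfolding eventually_at_right_field by (rule exI[of _ 1]) auto
    ultimately have "eventually (\<lambda>t. 0 < f t \<and> 0 < t \<and> t < 1) (at_right 0)"
      by (rule eventually_conj)
    then obtain t where t: "0 < f t" "0 < t" "t < 1"
      using eventually_happens trivial_limit_at_right_real by blast
    have rt: "r t \<in> A" using t rA by simp
    have "utility (markup_price c (z t)) p \<noteq> utility (markup_price c (z t)) q"
      using t(1) by (auto simp: f_def G_markup_def attraction_eq)
    from G_markup_strict_quasiconvex[OF this t(2,3)]
    have "G_markup G c (z t) (r t) < G_markup G c (z t) p"
      using t(1) by (simp add: f_def r_def)
    \<comment> \<open>Since \<open>z t\<close> is optimal for \<open>r t\<close>, the left side is
      the optimal profit of \<open>r t\<close>; it falls below the minimum attained at
      \<open>p\<close>.\<close>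
    then have "profit G c (markup_price c (z t)) (r t) < profit G c (markup_price c (z t)) p"
      using optimal_markup_pos[OF unif[OF rt]] by (intro profit_markup_strict_mono) (auto simp: z_def)
    also have "\<dots> \<le> optimal_profit G c p" by (rule profit_le_optimal[OF unif[OF p(1)]])
    finally show False
      using p(2)[OF rt] profit_optimal_markup[OF unif[OF rt]] by (simp add: z_def)
  qed
  then have "solves_fixed_point G c A (optimal_markup G c p) p"
    using p(1) by (auto simp: solves_fixed_point_def is_arg_min_def optimal_markup_def)
  then show ?thesis ..
qed

section \<open>Uniqueness, saddle point and minimax equality\<close>

lemma solves_fixed_pointD:
  assumes "solves_fixed_point G c A z p"
  shows "p \<in> A" and "uniform_sensitivity p" and "z = optimal_markup G c p"
    and "\<And>q. q \<in> A \<Longrightarrow> G_markup G c z p \<le> G_markup G c z q"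
  using assms unif by (auto simp: solves_fixed_point_def is_arg_min_def optimal_markup_def not_less)

text \<open>Both minimizers have the same G at \<open>z\<close>, so b z = 1 + G forces equal
  sensitivities. Different utilities would make the midpoint better than both; equal utilities then
  give equal first components.\<close>

lemma fixed_point_minimizer_unique:
  assumes p: "solves_fixed_point G c A z p" and q: "solves_fixed_point G c A z q"
  shows "q = p"
proof -
  note P = solves_fixed_pointD[OF p] and Q = solves_fixed_pointD[OF q]
  have eq: "G_markup G c z p = G_markup G c z q"
    using P(4)[OF Q(1)] Q(4)[OF P(1)] by simp
  have "common_value (snd p) * z = common_value (snd q) * z"
    using optimal_markup_first_order[OF P(2)] optimal_markup_first_order[OF Q(2)] eq
    by (simp flip: P(3) Q(3))
  then have "common_value (snd p) = common_value (snd q)"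
    using optimal_markup_pos[OF P(2)] P(3) by simp
  then have snd_eq: "snd p = snd q"
    using uniform_sensitivity_component[OF P(2)] uniform_sensitivity_component[OF Q(2)]
    by (simp add: vec_eq_iff)
  have "utility (markup_price c z) p = utility (markup_price c z) q"
  proof (rule ccontr)
    assume "utility (markup_price c z) p \<noteq> utility (markup_price c z) q"
    from G_markup_strict_quasiconvex[OF this, of "1/2"]
    have "G_markup G c z ((1 - 1/2) *\<^sub>R p + (1/2) *\<^sub>R q) < G_markup G c z p" using eq by simp
    moreover have "(1 - 1/2) *\<^sub>R p + (1/2) *\<^sub>R q \<in> A"
      by (rule convexD_alt[OF A(2) P(1) Q(1)]) auto
    ultimately show False using P(4) by fastforce
  qed
  then have "fst p = fst q" using snd_eq by (simp add: utility_def vec_eq_iff)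
  with snd_eq show ?thesis by (simp add: prod_eq_iff)
qed

text \<open>\<open>z\<close> is the optimal markup for \<open>p\<close>, and minimizing G at a
  positive markup minimizes profit.\<close>

lemma fixed_point_saddle:
  assumes "solves_fixed_point G c A z p"
  shows "saddle_point (profit G c) A (markup_price c z) p"
proof -
  note P = solves_fixed_pointD[OF assms]
  have "0 < z" using optimal_markup_pos[OF P(2)] P(3) by simp
  then have "profit G c (markup_price c z) p \<le> profit G c (markup_price c z) q" if "q \<in> A" for q
    using P(4)[OF that] by (rule profit_markup_mono)
  then show ?thesis
    using P(1) profit_le_optimal[OF P(2)] profit_optimal_markup[OF P(2)]
    by (simp add: saddle_point_def P(3))
qed

lemma ex_worst_case: "\<exists>g. \<forall>x. is_minimum (profit G c x) A (g x)"
proof -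
  have "\<exists>v. is_minimum (profit G c x) A v" for x
    using continuous_attains_inf[OF A(3,1) continuous_on_profit[of A x]]
    by (auto simp: is_minimum_def)
  then show ?thesis by metis
qed

text \<open>The worst case at another price is at most its profit under \<open>p\<close>, which is
  strictly below the saddle value because the optimum for known \<open>p\<close> is unique.\<close>

lemma fixed_point_unique_maxmin:
  assumes "solves_fixed_point G c A z p"
  shows "unique_maxmin_solution (profit G c) A (markup_price c z)"
proof -
  note P = solves_fixed_pointD[OF assms]
  obtain g where g: "\<And>x. is_minimum (profit G c x) A (g x)" using ex_worst_case by metis
  have "g y < g (markup_price c z)" if "y \<noteq> markup_price c z" for y
  proof -
    have "g y \<le> profit G c y p" using g P(1) by (auto simp: is_minimum_def)
    also have "\<dots> < profit G c (markup_price c z) p"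
      using profit_less_optimal[OF P(2), of y] that profit_optimal_markup[OF P(2)] P(3) by simp
    also have "\<dots> = g (markup_price c z)"
      using saddle_worst_case[OF fixed_point_saddle[OF assms] g] by simp
    finally show ?thesis .
  qed
  with g show ?thesis by (auto simp: unique_maxmin_solution_def)
qed

text \<open>Going round the two saddle points, alternately changing parameters and prices, gives a
  chain of inequalities from a profit to itself that is strict at the price changes.\<close>

lemma fixed_point_markup_unique:
  assumes "solves_fixed_point G c A z p" "solves_fixed_point G c A z' p'"
  shows "z = z'"
proof (rule ccontr)
  assume "z \<noteq> z'"
  then have neq: "markup_price c z \<noteq> markup_price c z'" by (simp add: markup_price_def vec_eq_iff)
  note P = solves_fixed_pointD[OF assms(1)] and P' = solves_fixed_pointD[OF assms(2)]
  have "profit G c (markup_price c z) p \<le> profit G c (markup_price c z) p'"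
    using fixed_point_saddle[OF assms(1)] P'(1) by (simp add: saddle_point_def)
  also have "\<dots> < profit G c (markup_price c z') p'"
    using profit_less_optimal[OF P'(2)] neq profit_optimal_markup[OF P'(2)] P'(3) by simp
  also have "\<dots> \<le> profit G c (markup_price c z') p"
    using fixed_point_saddle[OF assms(2)] P(1) by (simp add: saddle_point_def)
  finally show False
    using profit_less_optimal[OF P(2)] neq profit_optimal_markup[OF P(2)] P(3)
    by (metis not_less_iff_gr_or_eq)
qed

text \<open>The saddle value is both the largest worst-case profit and the least value of
  \<open>optimal_profit\<close> on \<open>A\<close>.\<close>

lemma profit_minimax_equality: "minimax_equality (profit G c) A"
proof -
  obtain z p where zp: "solves_fixed_point G c A z p" using ex_fixed_point by blast
  note P = solves_fixed_pointD[OF zp] and sad = fixed_point_saddle[OF zp]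
  obtain g where g: "\<And>x. is_minimum (profit G c x) A (g x)" using ex_worst_case by metis
  let ?v = "profit G c (markup_price c z) p"
  have v: "g (markup_price c z) = ?v" by (rule saddle_worst_case[OF sad g])
  have "g x \<le> ?v" for x
  proof -
    have "g x \<le> profit G c x p" using g P(1) by (auto simp: is_minimum_def)
    also have "\<dots> \<le> ?v" using sad by (simp add: saddle_point_def)
    finally show ?thesis .
  qed
  then have "is_maximum g UNIV ?v" using v by (auto simp: is_maximum_def image_iff intro!: exI[of _ "markup_price c z"])
  moreover have "is_maximum (\<lambda>x. profit G c x q) UNIV (optimal_profit G c q)" if "q \<in> A" for q
    using profit_le_optimal[OF unif[OF that]] profit_optimal_markup[OF unif[OF that]]
    by (auto simp: is_maximum_def image_iff intro!: exI[of _ "markup_price c (optimal_markup G c q)"])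
  moreover have "is_minimum (optimal_profit G c) A ?v"
  proof -
    have "?v \<le> optimal_profit G c q" if "q \<in> A" for q
      using sad profit_le_optimal[OF unif[OF that], of "markup_price c z"] that
      by (fastforce simp: saddle_point_def)
    moreover have "?v = optimal_profit G c p" using profit_optimal_markup[OF P(2)] P(3) by simp
    ultimately show ?thesis using P(1) by (auto simp: is_minimum_def)
  qed
  ultimately show ?thesis using g unfolding minimax_equality_def by blast
qed

end

end

theorem theorem1:
  fixes G :: "real ^ 'm \<Rightarrow> real"
    and c :: "real ^ 'm"
    and A :: "((real ^ 'm) \<times> (real ^ 'm)) set"
  assumes "GEV_CPGF G"
    and "A \<noteq> {}" and "convex A" and "compact A"
    and "\<And>a b. (a, b) \<in> A \<Longrightarrow> (\<forall>i j. b $ i = b $ j) \<and> (\<forall>i. 0 < b $ i)"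
  shows "(\<exists>!z. \<exists>p. solves_fixed_point G c A z p) \<and>
    (\<forall>z p. solves_fixed_point G c A z p \<longrightarrow>
       (\<forall>q. solves_fixed_point G c A z q \<longrightarrow> q = p) \<and>
       unique_maxmin_solution (profit G c) A (markup_price c z) \<and>
       saddle_point (profit G c) A (markup_price c z) p) \<and>
    minimax_equality (profit G c) A"
proof -
  have unif: "uniform_sensitivity p" if "p \<in> A" for p
    unfolding uniform_sensitivity_def using assms(5)[of "fst p" "snd p"] that by simp
  note hyps = assms(1-4) unif
  show ?thesis
    using ex_fixed_point[OF hyps] fixed_point_markup_unique[OF hyps]
      fixed_point_minimizer_unique[OF hyps] fixed_point_unique_maxmin[OF hyps]
      fixed_point_saddle[OF hyps] profit_minimax_equality[OF hyps]
    by metis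
qed

end
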